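(* Let $\Phi\cup\{\psi\}\subseteq\mathcal L$ and let $\Phi^n=\{\varphi^n\mid\varphi\in\Phi\}$, where for a formula $\varphi$ with $\mathcal R(\varphi)=\{\alpha_1,\dots,\alpha_k\}$ we put $\varphi^n:=\neg\neg\alpha_1\sqcup\dots\sqcup\neg\neg\alpha_k$. Then $\Phi\models_{\mathsf{InqB}^\lor}\psi$ if and only if $\Phi^n\models_{\mathsf{InqI}}\psi^n$.
   Context: Fix a set $\mathcal P$ of atomic sentences. The language $\mathcal L$ is given by $\varphi::=p\mid\bot\mid\varphi\land\varphi\mid\varphi\lor\varphi\mid\varphi\to\varphi\mid\varphi\sqcup\varphi$ with $p\in\mathcal P$, where $\lor$ is standard disjunction and $\sqcup$ denotes inquisitive disjunction; $\neg\varphi:=\varphi\to\bot$. Intuitionistic semantics ($\mathsf{InqI}$). An intuitionistic Kripke model is $M=\langle W,R,V\rangle$ with $W$ a set (of worlds), $R$ a partial order on $W$, and $V:W\times\mathcal P\to\{0,1\}$ such that $wRw'$ and $V(w,p)=1$ imply $V(w',p)=1$. A team is a set $t\subseteq W$; $R[w]=\{w'\mid wRw'\}$ and $R[t]=\bigcup_{w\in t}R[w]$. Support $M,t\models\varphi$ is defined by: - $M,t\models p$ iff $V(w,p)=1$ for all $w\in t$; - $M,t\models\bot$ iff $t=\emptyset$; - $M,t\models\varphi\land\psi$ iff $M,t\models\varphi$ and $M,t\models\psi$; - $M,t\models\varphi\lor\psi$ iff there are $t',t''$ with $t=t'\cup t''$, $M,t'\models\varphi$ and $M,t''\models\psi$;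 - $M,t\models\varphi\to\psi$ iff for all $t'\subseteq R[t]$, $M,t'\models\varphi$ implies $M,t'\models\psi$; - $M,t\models\varphi\sqcup\psi$ iff $M,t\models\varphi$ or $M,t\models\psi$. $\Phi\models_{\mathsf{InqI}}\psi$ means: for every intuitionistic Kripke model $M$ and team $t$ in $M$, if $M,t\models\varphi$ for all $\varphi\in\Phi$ then $M,t\models\psi$. Classical semantics ($\mathsf{InqB}^\lor$). A classical possible world model is $M=\langle W,V\rangle$ with $W$ a set and $V:W\times\mathcal P\to\{0,1\}$ any function; teams are sets $t\subseteq W$; support is defined by the same clauses, except that $M,t\models\varphi\to\psi$ iff for all $t'\subseteq t$, $M,t'\models\varphi$ implies $M,t'\models\psi$. $\Phi\models_{\mathsf{InqB}^\lor}\psi$ means: for every classical possible world model $M$ and team $t$ in $M$, if $M,t\models\varphi$ for all $\varphi\in\Phi$ then $M,t\models\psi$. The (finite, nonempty) set $\mathcal R(\varphi)$ of resolutions of $\varphi$ is defined by: $\mathcal R(p)=\{p\}$; $\mathcal R(\bot)=\{\bot\}$; $\mathcal R(\varphi\land\psi)=\{\alpha\land\beta\mid\alpha\in\mathcal R(\varphi),\beta\in\mathcal R(\psi)\}$; $\mathcal R(\varphi\lor\psi)=\{\alpha\lor\beta\mid\alpha\in\mathcal R(\varphi),\beta\in\mathcal R(\psi)\}$; $\mathcal R(\varphi\to\psi)=\{\bigwedge_{\alpha\in\mathcal R(\varphi)}(\alpha\to f(\alpha))\mid f:\mathcal R(\varphi)\to\mathcal R(\psi)\}$; $\mathcal R(\varphi\sqcup\psi)=\mathcal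 R(\varphi)\cup\mathcal R(\psi)$. Finite conjunctions and inquisitive disjunctions are formed in some fixed order and bracketing (immaterial up to equivalence). *)

theory Defs
  imports Main "HOL-Library.FuncSet"
begin

section \<open>Syntax\<close>

text \<open>\<open>Or\<close> is the standard disjunction, \<open>IDisj\<close> the inquisitive one.\<close>

datatype 'p form =
    Atom 'p
  | Bot
  | And "'p form" "'p form"
  | Or "'p form" "'p form"
  | Imp "'p form" "'p form"
  | IDisj "'p form" "'p form"

definition Neg :: "'p form \<Rightarrow> 'p form" where
  "Neg \<phi> = Imp \<phi> Bot"

section \<open>Intuitionistic semantics\<close>

record ('w, 'p) kmodel =
  kW :: "'w set"
  kR :: "('w \<times> 'w) set"
  kV :: "'w \<Rightarrow> 'p \<Rightarrow> bool"

definition is_kmodel :: "('w, 'p) kmodel \<Rightarrow> bool" where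
  "is_kmodel M \<longleftrightarrow> partial_order_on (kW M) (kR M) \<and>
     (\<forall>w w' p. (w, w') \<in> kR M \<longrightarrow> kV M w p \<longrightarrow> kV M w' p)"

primrec supI :: "('w, 'p) kmodel \<Rightarrow> 'w set \<Rightarrow> 'p form \<Rightarrow> bool" where
  "supI M t (Atom p) \<longleftrightarrow> (\<forall>w\<in>t. kV M w p)"
| "supI M t Bot \<longleftrightarrow> t = {}"
| "supI M t (And \<phi> \<psi>) \<longleftrightarrow> supI M t \<phi> \<and> supI M t \<psi>"
| "supI M t (Or \<phi> \<psi>) \<longleftrightarrow> (\<exists>t' t''. t = t' \<union> t'' \<and> supI M t' \<phi> \<and> supI M t'' \<psi>)"
| "supI M t (Imp \<phi> \<psi>) \<longleftrightarrow> (\<forall>t'. t' \<subseteq> kR M `` t \<longrightarrow> supI M t' \<phi> \<longrightarrow> supI M t' \<psi>)"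
| "supI M t (IDisj \<phi> \<psi>) \<longleftrightarrow> supI M t \<phi> \<or> supI M t \<psi>"

definition entails_InqI_over :: "'w itself \<Rightarrow> 'p form set \<Rightarrow> 'p form \<Rightarrow> bool" where
  "entails_InqI_over TYPE('w) \<Phi> \<psi> \<longleftrightarrow>
     (\<forall>(M :: ('w, 'p) kmodel) t. is_kmodel M \<longrightarrow> t \<subseteq> kW M \<longrightarrow>
        (\<forall>\<phi>\<in>\<Phi>. supI M t \<phi>) \<longrightarrow> supI M t \<psi>)"

text \<open>
  HOL cannot quantify over the type of worlds inside a formula. Entailment is therefore
  stated over one type of worlds that is large enough: by \<open>entails_InqI_all_types\<close> and
  \<open>entails_InqB_all_types\<close> below, entailment over the type \<^typ>\<open>'p form list\<close> implies entailment
  over every type, so that the definitions do range over all models.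
\<close>

definition entails_InqI :: "'p form set \<Rightarrow> 'p form \<Rightarrow> bool" (infix \<open>\<Turnstile>\<^sub>I\<close> 50) where
  "\<Phi> \<Turnstile>\<^sub>I \<psi> \<longleftrightarrow> entails_InqI_over TYPE('p form list) \<Phi> \<psi>"

section \<open>Classical semantics\<close>

record ('w, 'p) cmodel =
  cW :: "'w set"
  cV :: "'w \<Rightarrow> 'p \<Rightarrow> bool"

primrec supB :: "('w, 'p) cmodel \<Rightarrow> 'w set \<Rightarrow> 'p form \<Rightarrow> bool" where
  "supB M t (Atom p) \<longleftrightarrow> (\<forall>w\<in>t. cV M w p)"
| "supB M t Bot \<longleftrightarrow> t = {}"
| "supB M t (And \<phi> \<psi>) \<longleftrightarrow> supB M t \<phi> \<and> supB M t \<psi>"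
| "supB M t (Or \<phi> \<psi>) \<longleftrightarrow> (\<exists>t' t''. t = t' \<union> t'' \<and> supB M t' \<phi> \<and> supB M t'' \<psi>)"
| "supB M t (Imp \<phi> \<psi>) \<longleftrightarrow> (\<forall>t'. t' \<subseteq> t \<longrightarrow> supB M t' \<phi> \<longrightarrow> supB M t' \<psi>)"
| "supB M t (IDisj \<phi> \<psi>) \<longleftrightarrow> supB M t \<phi> \<or> supB M t \<psi>"

definition entails_InqB_over :: "'w itself \<Rightarrow> 'p form set \<Rightarrow> 'p form \<Rightarrow> bool" where
  "entails_InqB_over TYPE('w) \<Phi> \<psi> \<longleftrightarrow>
     (\<forall>(M :: ('w, 'p) cmodel) t. t \<subseteq> cW M \<longrightarrow>
        (\<forall>\<phi>\<in>\<Phi>. supB M t \<phi>) \<longrightarrow> supB M t \<psi>)"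

definition entails_InqB :: "'p form set \<Rightarrow> 'p form \<Rightarrow> bool" (infix \<open>\<Turnstile>\<^sub>B\<close> 50) where
  "\<Phi> \<Turnstile>\<^sub>B \<psi> \<longleftrightarrow> entails_InqB_over TYPE('p form list) \<Phi> \<psi>"

section \<open>Resolutions and the negative translation\<close>

text \<open>The fixed order in which the elements of a finite set are listed is left unspecified.\<close>

definition enum_set :: "'a set \<Rightarrow> 'a list" where
  "enum_set A = (SOME xs. distinct xs \<and> set xs = A)"

text \<open>Iterated connectives are bracketed to the right; the empty cases are never used, since
  sets of resolutions are finite and nonempty (\<open>finite_Res\<close>, \<open>Res_nonempty\<close>).\<close>

fun BigAnd :: "'p form list \<Rightarrow> 'p form" where
  "BigAnd [] = Imp Bot Bot"
| "BigAnd [\<phi>] = \<phi>"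
| "BigAnd (\<phi> # \<psi> # xs) = And \<phi> (BigAnd (\<psi> # xs))"

fun BigIDisj :: "'p form list \<Rightarrow> 'p form" where
  "BigIDisj [] = Bot"
| "BigIDisj [\<phi>] = \<phi>"
| "BigIDisj (\<phi> # \<psi> # xs) = IDisj \<phi> (BigIDisj (\<psi> # xs))"

primrec Res :: "'p form \<Rightarrow> 'p form set" where
  "Res (Atom p) = {Atom p}"
| "Res Bot = {Bot}"
| "Res (And \<phi> \<psi>) = {And \<alpha> \<beta> | \<alpha> \<beta>. \<alpha> \<in> Res \<phi> \<and> \<beta> \<in> Res \<psi>}"
| "Res (Or \<phi> \<psi>) = {Or \<alpha> \<beta> | \<alpha> \<beta>. \<alpha> \<in> Res \<phi> \<and> \<beta> \<in> Res \<psi>}"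
| "Res (Imp \<phi> \<psi>) =
     {BigAnd (map (\<lambda>\<alpha>. Imp \<alpha> (f \<alpha>)) (enum_set (Res \<phi>))) | f. f \<in> Res \<phi> \<rightarrow>\<^sub>E Res \<psi>}"
| "Res (IDisj \<phi> \<psi>) = Res \<phi> \<union> Res \<psi>"

definition neg_trans :: "'p form \<Rightarrow> 'p form" where
  "neg_trans \<phi> = BigIDisj (map (\<lambda>\<alpha>. Neg (Neg \<alpha>)) (enum_set (Res \<phi>)))"

lemma enum_set:
  assumes "finite A"
  shows "distinct (enum_set A)" "set (enum_set A) = A"
proof -
  have "\<exists>xs. distinct xs \<and> set xs = A"
    using finite_distinct_list[OF assms] by blast
  from someI_ex[OF this] show "distinct (enum_set A)" "set (enum_set A) = A"
    unfolding enum_set_def by auto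
qed

lemma finite_Res: "finite (Res \<phi>)"
proof (induction \<phi>)
  case (And \<phi> \<psi>)
  have "Res (And \<phi> \<psi>) = (\<lambda>(\<alpha>, \<beta>). And \<alpha> \<beta>) ` (Res \<phi> \<times> Res \<psi>)" by auto
  then show ?case using And by simp
next
  case (Or \<phi> \<psi>)
  have "Res (Or \<phi> \<psi>) = (\<lambda>(\<alpha>, \<beta>). Or \<alpha> \<beta>) ` (Res \<phi> \<times> Res \<psi>)" by auto
  then show ?case using Or by simp
next
  case (Imp \<phi> \<psi>)
  have "Res (Imp \<phi> \<psi>) =
      (\<lambda>f. BigAnd (map (\<lambda>\<alpha>. Imp \<alpha> (f \<alpha>)) (enum_set (Res \<phi>)))) ` (Res \<phi> \<rightarrow>\<^sub>E Res \<psi>)"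
    by auto
  then show ?case using Imp by (simp add: finite_PiE)
qed auto

lemma Res_nonempty: "Res \<phi> \<noteq> {}"
proof (induction \<phi>)
  case (Imp \<phi> \<psi>)
  then have "Res \<phi> \<rightarrow>\<^sub>E Res \<psi> \<noteq> {}" by (simp add: PiE_eq_empty_iff)
  then show ?case by auto
qed auto

section \<open>Entailment does not depend on the type of worlds\<close>

primrec std :: "'p form \<Rightarrow> bool" where
  "std (Atom p) \<longleftrightarrow> True"
| "std Bot \<longleftrightarrow> True"
| "std (And \<phi> \<psi>) \<longleftrightarrow> std \<phi> \<and> std \<psi>"
| "std (Or \<phi> \<psi>) \<longleftrightarrow> std \<phi> \<and> std \<psi>"
| "std (Imp \<phi> \<psi>) \<longleftrightarrow> std \<phi> \<and> std \<psi>"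
| "std (IDisj \<phi> \<psi>) \<longleftrightarrow> False"

lemma std_BigAnd: "(\<And>\<phi>. \<phi> \<in> set xs \<Longrightarrow> std \<phi>) \<Longrightarrow> std (BigAnd xs)"
  by (induction xs rule: BigAnd.induct) auto

lemma std_Res: "\<alpha> \<in> Res \<phi> \<Longrightarrow> std \<alpha>"
proof (induction \<phi> arbitrary: \<alpha>)
  case (Imp \<phi> \<psi>)
  then obtain f where f: "f \<in> Res \<phi> \<rightarrow>\<^sub>E Res \<psi>"
    and \<alpha>: "\<alpha> = BigAnd (map (\<lambda>\<alpha>. Imp \<alpha> (f \<alpha>)) (enum_set (Res \<phi>)))" by auto
  show ?case unfolding \<alpha>
    by (rule std_BigAnd) (use f Imp.IH in \<open>auto simp: enum_set finite_Res dest: PiE_mem\<close>)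
qed auto

lemma supI_BigAnd: "supI M t (BigAnd xs) \<longleftrightarrow> (\<forall>\<phi>\<in>set xs. supI M t \<phi>)"
  by (induction xs rule: BigAnd.induct) auto

lemma supI_empty: "supI M {} \<phi>"
  by (induction \<phi>) auto

lemma supI_OrI:
  "supI M t' \<phi> \<Longrightarrow> supI M t'' \<psi> \<Longrightarrow> t = t' \<union> t'' \<Longrightarrow> supI M t (Or \<phi> \<psi>)"
  unfolding supI.simps by (intro exI conjI)

lemma supI_mono: "supI M t \<phi> \<Longrightarrow> t' \<subseteq> t \<Longrightarrow> supI M t' \<phi>"
proof (induction \<phi> arbitrary: t t')
  case (And \<phi> \<psi>)
  have "supI M t' \<phi>" by (rule And.IH(1)[of t]) (use And.prems in simp_all)
  moreover have "supI M t' \<psi>" by (rule And.IH(2)[of t]) (use And.prems in simp_all)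
  ultimately show ?case by simp
next
  case (Or \<phi> \<psi>)
  then obtain a b where ab: "t = a \<union> b" "supI M a \<phi>" "supI M b \<psi>" by auto
  have "supI M (a \<inter> t') \<phi>" by (rule Or.IH(1)[OF ab(2)]) simp
  moreover have "supI M (b \<inter> t') \<psi>" by (rule Or.IH(2)[OF ab(3)]) simp
  moreover have "t' = (a \<inter> t') \<union> (b \<inter> t')" using ab(1) Or.prems(2) by blast
  ultimately show ?case by (rule supI_OrI)
next
  case (Imp \<phi> \<psi>)
  have "kR M `` t' \<subseteq> kR M `` t" using Imp.prems(2) by blast
  then show ?case using Imp.prems(1) by (simp add: subset_trans)
next
  case (IDisj \<phi> \<psi>)
  from IDisj.prems(1) consider "supI M t \<phi>" | "supI M t \<psi>" by auto
  then show ?case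
  proof cases
    case 1
    then show ?thesis using IDisj.IH(1)[OF _ IDisj.prems(2)] by simp
  next
    case 2
    then show ?thesis using IDisj.IH(2)[OF _ IDisj.prems(2)] by simp
  qed
qed auto

lemma supI_world_Or: "supI M {w} (Or \<phi> \<psi>) \<longleftrightarrow> supI M {w} \<phi> \<or> supI M {w} \<psi>"
proof
  assume "supI M {w} (Or \<phi> \<psi>)"
  then obtain a b where "{w} = a \<union> b" "supI M a \<phi>" "supI M b \<psi>" by auto
  moreover from this have "a = {w} \<or> b = {w}" by blast
  ultimately show "supI M {w} \<phi> \<or> supI M {w} \<psi>" by blast
next
  assume "supI M {w} \<phi> \<or> supI M {w} \<psi>"
  then show "supI M {w} (Or \<phi> \<psi>)"
    using supI_OrI[of M "{w}" \<phi> "{}" \<psi>] supI_OrI[of M "{}" \<phi> "{w}" \<psi>] supI_empty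
    by fastforce
qed

lemma supI_flat: "std \<phi> \<Longrightarrow> supI M t \<phi> \<longleftrightarrow> (\<forall>w\<in>t. supI M {w} \<phi>)"
proof (induction \<phi> arbitrary: t)
  case (And \<phi> \<psi>)
  then have "supI M t \<phi> \<longleftrightarrow> (\<forall>w\<in>t. supI M {w} \<phi>)" "supI M t \<psi> \<longleftrightarrow> (\<forall>w\<in>t. supI M {w} \<psi>)"
    unfolding std.simps by blast+
  then show ?case by (simp only: supI.simps ball_conj_distrib)
next
  case (Or \<phi> \<psi>)
  show ?case
  proof
    assume *: "supI M t (Or \<phi> \<psi>)"
    show "\<forall>w\<in>t. supI M {w} (Or \<phi> \<psi>)"
    proof
      fix w assume "w \<in> t"
      then have "{w} \<subseteq> t" by simp
      then show "supI M {w} (Or \<phi> \<psi>)" by (rule supI_mono[OF *])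
    qed
  next
    assume *: "\<forall>w\<in>t. supI M {w} (Or \<phi> \<psi>)"
    have pt: "supI M {w} \<phi> \<or> supI M {w} \<psi>" if "w \<in> t" for w
      using * that supI_world_Or[of M w \<phi> \<psi>] by (simp only:)
    have "supI M {w\<in>t. supI M {w} \<phi>} \<phi>" 
      using Or.IH(1)[of "{w\<in>t. supI M {w} \<phi>}"] Or.prems by simp
    moreover have "supI M {w\<in>t. supI M {w} \<psi>} \<psi>"
      using Or.IH(2)[of "{w\<in>t. supI M {w} \<psi>}"] Or.prems by simp
    moreover have "t = {w\<in>t. supI M {w} \<phi>} \<union> {w\<in>t. supI M {w} \<psi>}" using pt by blast
    ultimately show "supI M t (Or \<phi> \<psi>)" by (rule supI_OrI)
  qed
next
  case (Imp \<phi> \<psi>)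
  show ?case
  proof
    assume *: "supI M t (Imp \<phi> \<psi>)"
    show "\<forall>w\<in>t. supI M {w} (Imp \<phi> \<psi>)"
    proof
      fix w assume "w \<in> t"
      then have "{w} \<subseteq> t" by simp
      then show "supI M {w} (Imp \<phi> \<psi>)" by (rule supI_mono[OF *])
    qed
  next
    assume *: "\<forall>w\<in>t. supI M {w} (Imp \<phi> \<psi>)"
    have "supI M t' \<psi>" if t': "t' \<subseteq> kR M `` t" "supI M t' \<phi>" for t'
    proof -
      have "supI M {v} \<psi>" if v: "v \<in> t'" for v
      proof -
        obtain w where "w \<in> t" "v \<in> kR M `` {w}" using v t' by blast
        moreover have "supI M {v} \<phi>" using supI_mono[OF t'(2)] that by simp
        ultimately show ?thesis using * by simp
      qed
      then show ?thesis using Imp.IH(2)[of t'] Imp.prems by simp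
    qed
    then show "supI M t (Imp \<phi> \<psi>)" by simp
  qed
qed auto

lemma supI_world_Imp:
  assumes "std \<phi>" "std \<psi>"
  shows "supI M {w} (Imp \<phi> \<psi>) \<longleftrightarrow> (\<forall>v. (w, v) \<in> kR M \<longrightarrow> supI M {v} \<phi> \<longrightarrow> supI M {v} \<psi>)"
proof
  assume "supI M {w} (Imp \<phi> \<psi>)"
  then show "\<forall>v. (w, v) \<in> kR M \<longrightarrow> supI M {v} \<phi> \<longrightarrow> supI M {v} \<psi>" by auto
next
  assume *: "\<forall>v. (w, v) \<in> kR M \<longrightarrow> supI M {v} \<phi> \<longrightarrow> supI M {v} \<psi>"
  have "supI M t' \<psi>" if t': "t' \<subseteq> kR M `` {w}" "supI M t' \<phi>" for t'
  proof -
    have "supI M {v} \<phi>" if "v \<in> t'" for v using supI_mono[OF t'(2)] that by simp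
    then show ?thesis using * t' assms supI_flat[of \<psi> M t'] by blast
  qed
  then show "supI M {w} (Imp \<phi> \<psi>)" by simp
qed

lemma supI_Res: "supI M t \<phi> \<longleftrightarrow> (\<exists>\<alpha>\<in>Res \<phi>. supI M t \<alpha>)"
proof (induction \<phi> arbitrary: t)
  case (And \<phi> \<psi>)
  have "supI M t \<phi> = (\<exists>\<alpha>\<in>Res \<phi>. supI M t \<alpha>)" "supI M t \<psi> = (\<exists>\<alpha>\<in>Res \<psi>. supI M t \<alpha>)"
    using And by blast+
  then show ?case by fastforce
next
  case (Or \<phi> \<psi>)
  have "supI M t (Or \<phi> \<psi>) \<longleftrightarrow> (\<exists>t' t''. t = t' \<union> t'' \<and>
      (\<exists>\<alpha>\<in>Res \<phi>. supI M t' \<alpha>) \<and> (\<exists>\<beta>\<in>Res \<psi>. supI M t'' \<beta>))"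
    using Or by simp
  also have "\<dots> \<longleftrightarrow> (\<exists>\<alpha>\<in>Res \<phi>. \<exists>\<beta>\<in>Res \<psi>. supI M t (Or \<alpha> \<beta>))"
    unfolding supI.simps by blast
  also have "\<dots> \<longleftrightarrow> (\<exists>\<gamma>\<in>Res (Or \<phi> \<psi>). supI M t \<gamma>)"
    unfolding Res.simps by blast
  finally show ?case .
next
  case (Imp \<phi> \<psi>)
  show ?case
  proof
    assume imp: "supI M t (Imp \<phi> \<psi>)"
    have "\<exists>\<beta>. \<beta> \<in> Res \<psi> \<and> supI M {v \<in> kR M `` t. supI M {v} \<alpha>} \<beta>" if "\<alpha> \<in> Res \<phi>" for \<alpha>
    proof -
      let ?t = "{v \<in> kR M `` t. supI M {v} \<alpha>}"
      have "supI M ?t \<alpha>" using supI_flat[OF std_Res[OF that], of M ?t] by simp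
      then have "supI M ?t \<phi>" using Imp.IH that by blast
      moreover have "?t \<subseteq> kR M `` t" by blast
      ultimately have "supI M ?t \<psi>" using imp by simp
      then show ?thesis using Imp.IH by blast
    qed
    then obtain f where f: "\<And>\<alpha>. \<alpha> \<in> Res \<phi> \<Longrightarrow> f \<alpha> \<in> Res \<psi> \<and>
        supI M {v \<in> kR M `` t. supI M {v} \<alpha>} (f \<alpha>)" by metis
    let ?f = "restrict f (Res \<phi>)"
    let ?\<gamma> = "BigAnd (map (\<lambda>\<alpha>. Imp \<alpha> (?f \<alpha>)) (enum_set (Res \<phi>)))"
    have "?f \<in> Res \<phi> \<rightarrow>\<^sub>E Res \<psi>" using f by simp
    then have "?\<gamma> \<in> Res (Imp \<phi> \<psi>)" unfolding Res.simps by blast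
    moreover have "supI M t (Imp \<alpha> (?f \<alpha>))" if \<alpha>: "\<alpha> \<in> Res \<phi>" for \<alpha>
    proof -
      have "supI M t' (f \<alpha>)" if t': "t' \<subseteq> kR M `` t" "supI M t' \<alpha>" for t'
      proof -
        have "supI M {v} \<alpha>" if "v \<in> t'" for v using supI_mono[OF t'(2)] that by simp
        then have "t' \<subseteq> {v \<in> kR M `` t. supI M {v} \<alpha>}" using t' by blast
        then show ?thesis using f[OF \<alpha>] supI_mono by blast
      qed
      then show ?thesis using \<alpha> by simp
    qed
    ultimately show "\<exists>\<gamma>\<in>Res (Imp \<phi> \<psi>). supI M t \<gamma>"
      using supI_BigAnd[of M t "map (\<lambda>\<alpha>. Imp \<alpha> (?f \<alpha>)) (enum_set (Res \<phi>))"]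
      by (intro bexI[of _ ?\<gamma>]) (auto simp: enum_set finite_Res)
  next
    assume "\<exists>\<gamma>\<in>Res (Imp \<phi> \<psi>). supI M t \<gamma>"
    then obtain f where f: "f \<in> Res \<phi> \<rightarrow>\<^sub>E Res \<psi>"
      and "supI M t (BigAnd (map (\<lambda>\<alpha>. Imp \<alpha> (f \<alpha>)) (enum_set (Res \<phi>))))" by auto
    then have *: "supI M t (Imp \<alpha> (f \<alpha>))" if "\<alpha> \<in> Res \<phi>" for \<alpha>
      using that by (simp add: supI_BigAnd enum_set finite_Res)
    have "supI M t' \<psi>" if t': "t' \<subseteq> kR M `` t" "supI M t' \<phi>" for t'
    proof -
      obtain \<alpha> where \<alpha>: "\<alpha> \<in> Res \<phi>" "supI M t' \<alpha>" using t' Imp.IH by blast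
      then have "supI M t' (f \<alpha>)" using *[OF \<alpha>(1)] t' by simp
      moreover have "f \<alpha> \<in> Res \<psi>" using f \<alpha> by auto
      ultimately show ?thesis using Imp.IH by blast
    qed
    then show "supI M t (Imp \<phi> \<psi>)" by simp
  qed
next
  case (IDisj \<phi> \<psi>)
  have "supI M t \<phi> = (\<exists>\<alpha>\<in>Res \<phi>. supI M t \<alpha>)" "supI M t \<psi> = (\<exists>\<alpha>\<in>Res \<psi>. supI M t \<alpha>)"
    using IDisj by blast+
  then show ?case by (simp only: supI.simps Res.simps bex_Un)
qed simp_all

text \<open>
  A countermodel is cut down to the worlds reached from finitely many worlds of the team by
  repeatedly choosing a successor that refutes a given implication. These worlds are named by
  lists of formulas.
\<close>

lemma countermodel_transfer:
  fixes M :: "('w, 'p) kmodel"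
  assumes M: "is_kmodel M" and t: "t \<subseteq> kW M"
    and \<Phi>: "\<And>\<phi>. \<phi> \<in> \<Phi> \<Longrightarrow> supI M t \<phi>" and \<psi>: "\<not> supI M t \<psi>"
  obtains N :: "('p form list, 'p) kmodel" and u
    where "is_kmodel N" "u \<subseteq> kW N" "\<And>\<phi>. \<phi> \<in> \<Phi> \<Longrightarrow> supI N u \<phi>" "\<not> supI N u \<psi>"
      "kR M = Id_on (kW M) \<Longrightarrow> kR N = Id_on (kW N)"
proof -
  have "\<exists>w\<in>t. \<not> supI M {w} \<beta>" if "\<beta> \<in> Res \<psi>" for \<beta>
    using that \<psi> supI_Res[of M t \<psi>] supI_flat[OF std_Res[OF that], of M t] by blast
  then obtain r where r: "\<And>\<beta>. \<beta> \<in> Res \<psi> \<Longrightarrow> r \<beta> \<in> t \<and> \<not> supI M {r \<beta>} \<beta>" by metis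
  define s where "s \<chi> w = (case \<chi> of
      Imp \<alpha> \<gamma> \<Rightarrow> if \<exists>v. (w, v) \<in> kR M \<and> supI M {v} \<alpha> \<and> \<not> supI M {v} \<gamma>
        then SOME v. (w, v) \<in> kR M \<and> supI M {v} \<alpha> \<and> \<not> supI M {v} \<gamma> else w
    | _ \<Rightarrow> w)" for \<chi> w
  have s: "(w, s (Imp \<alpha> \<gamma>) w) \<in> kR M \<and> supI M {s (Imp \<alpha> \<gamma>) w} \<alpha> \<and>
      \<not> supI M {s (Imp \<alpha> \<gamma>) w} \<gamma>"
    if "(w, v) \<in> kR M" "supI M {v} \<alpha>" "\<not> supI M {v} \<gamma>" for w v \<alpha> \<gamma>
  proof -
    have ex: "\<exists>v. (w, v) \<in> kR M \<and> supI M {v} \<alpha> \<and> \<not> supI M {v} \<gamma>" using that by blast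
    have "s (Imp \<alpha> \<gamma>) w = (SOME v. (w, v) \<in> kR M \<and> supI M {v} \<alpha> \<and> \<not> supI M {v} \<gamma>)"
      unfolding s_def using ex by simp
    then show ?thesis using someI_ex[OF ex] by simp
  qed
  have RW: "kR M \<subseteq> kW M \<times> kW M" and refl: "\<And>w. w \<in> kW M \<Longrightarrow> (w, w) \<in> kR M"
    and trans: "trans (kR M)" and anti: "antisym (kR M)"
    and per: "\<And>w w' p. (w, w') \<in> kR M \<Longrightarrow> kV M w p \<Longrightarrow> kV M w' p"
    using M unfolding is_kmodel_def partial_order_on_def preorder_on_def refl_on_def by blast+
  have sW: "s \<chi> w \<in> kW M" if "w \<in> kW M" for \<chi> w
  proof (cases \<chi>)
    case (Imp \<alpha> \<gamma>)
    show ?thesis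
    proof (cases "\<exists>v. (w, v) \<in> kR M \<and> supI M {v} \<alpha> \<and> \<not> supI M {v} \<gamma>")
      case True
      then have "(w, s \<chi> w) \<in> kR M" using s[of w _ \<alpha> \<gamma>] Imp by blast
      then show ?thesis using RW by blast
    next
      case False
      then have "s \<chi> w = w" unfolding s_def Imp form.case by (simp only: if_False)
      then show ?thesis using that by simp
    qed
  qed (use that in \<open>auto simp: s_def\<close>)
  define g where "g xs = fold s (tl xs) (r (hd xs))" for xs
  define P where "P = {\<beta> # xs | \<beta> xs. \<beta> \<in> Res \<psi>}"
  have gW: "g xs \<in> kW M" if xs: "xs \<in> P" for xs
  proof -
    have "fold s ys w \<in> kW M" if "w \<in> kW M" for ys w
      using that by (induction ys arbitrary: w) (auto intro: sW)
    moreover obtain \<beta> ys where "xs = \<beta> # ys" "\<beta> \<in> Res \<psi>" using xs by (auto simp: P_def)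
    moreover have "r \<beta> \<in> kW M" using calculation r t by blast
    ultimately show ?thesis by (simp add: g_def)
  qed
  have gs: "s \<chi> (g xs) = g (xs @ [\<chi>])" "xs @ [\<chi>] \<in> P" if "xs \<in> P" for \<chi> xs
    using that by (auto simp: g_def P_def)
  define e where "e = inv_into P g"
  define D where "D = e ` g ` P"
  have e: "e w \<in> D" "g (e w) = w" if "w \<in> g ` P" for w
    using that by (auto simp: e_def D_def f_inv_into_f)
  have ge: "e (g x) = x" "g x \<in> g ` P" if "x \<in> D" for x
    using that by (auto simp: D_def e_def f_inv_into_f)
  define N where "N = \<lparr>kW = D, kR = {(x, y). x \<in> D \<and> y \<in> D \<and> (g x, g y) \<in> kR M},
    kV = (\<lambda>x. kV M (g x))\<rparr>"
  have DW: "g x \<in> kW M" if "x \<in> D" for x using ge(2)[OF that] gW by auto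
  have N: "is_kmodel N"
    unfolding is_kmodel_def partial_order_on_def preorder_on_def
  proof (intro conjI allI impI)
    show "kR N \<subseteq> kW N \<times> kW N" by (auto simp: N_def)
    show "refl_on (kW N) (kR N)" using refl DW by (auto simp: N_def refl_on_def)
    show "trans (kR N)" using trans unfolding N_def trans_def by simp blast
    show "antisym (kR N)"
    proof (rule antisymI)
      fix x y assume "(x, y) \<in> kR N" "(y, x) \<in> kR N"
      then have "x \<in> D" "y \<in> D" "g x = g y" using anti by (auto simp: N_def antisym_def)
      then show "x = y" using ge by metis
    qed
    show "kV N w' p" if "(w, w') \<in> kR N" "kV N w p" for w w' p
      using that per by (auto simp: N_def)
  qed
  have truth: "supI N {x} \<alpha> \<longleftrightarrow> supI M {g x} \<alpha>" if "std \<alpha>" "x \<in> D" for x \<alpha>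
    using that
  proof (induction \<alpha> arbitrary: x)
    case (Atom p)
    then show ?case by (simp add: N_def)
  next
    case (Or \<alpha> \<gamma>)
    then have "supI N {x} \<alpha> = supI M {g x} \<alpha>" "supI N {x} \<gamma> = supI M {g x} \<gamma>" by simp_all
    then show ?case by (simp only: supI_world_Or)
  next
    case (Imp \<alpha> \<gamma>)
    then have sd: "std \<alpha>" "std \<gamma>" by simp_all
    have "(\<forall>y. (x, y) \<in> kR N \<longrightarrow> supI N {y} \<alpha> \<longrightarrow> supI N {y} \<gamma>) \<longleftrightarrow>
      (\<forall>v. (g x, v) \<in> kR M \<longrightarrow> supI M {v} \<alpha> \<longrightarrow> supI M {v} \<gamma>)"
    proof (intro iffI allI impI)
      fix v
      assume *: "\<forall>y. (x, y) \<in> kR N \<longrightarrow> supI N {y} \<alpha> \<longrightarrow> supI N {y} \<gamma>"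
        and v: "(g x, v) \<in> kR M" "supI M {v} \<alpha>"
      show "supI M {v} \<gamma>"
      proof (rule ccontr)
        assume "\<not> supI M {v} \<gamma>"
        note sv = s[OF v this]
        obtain xs where xs: "xs \<in> P" "g x = g xs" using ge(2)[OF Imp.prems(2)] by auto
        let ?v = "s (Imp \<alpha> \<gamma>) (g x)"
        have "?v \<in> g ` P" using gs[OF xs(1)] xs(2) by auto
        then have ev: "e ?v \<in> D" "g (e ?v) = ?v" using e by blast+
        then have "(x, e ?v) \<in> kR N" using sv Imp.prems by (simp add: N_def)
        then show False using * Imp.IH(1)[OF sd(1) ev(1)] Imp.IH(2)[OF sd(2) ev(1)] ev sv by simp
      qed
    next
      fix y
      assume *: "\<forall>v. (g x, v) \<in> kR M \<longrightarrow> supI M {v} \<alpha> \<longrightarrow> supI M {v} \<gamma>"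
        and y: "(x, y) \<in> kR N" "supI N {y} \<alpha>"
      then have "y \<in> D" "(g x, g y) \<in> kR M" by (auto simp: N_def)
      then show "supI N {y} \<gamma>" using * y Imp.IH sd by blast
    qed
    then show ?case by (simp only: supI_world_Imp[OF sd])
  qed auto
  define u where "u = (\<lambda>\<beta>. e (r \<beta>)) ` Res \<psi>"
  have rP: "r \<beta> \<in> g ` P" if "\<beta> \<in> Res \<psi>" for \<beta>
  proof -
    have "[\<beta>] \<in> P" "g [\<beta>] = r \<beta>" using that by (auto simp: P_def g_def)
    then show ?thesis by force
  qed
  have uD: "u \<subseteq> D" using rP e by (auto simp: u_def)
  have ut: "g x \<in> t" if "x \<in> u" for x using that rP e r by (auto simp: u_def)
  show thesis
  proof (rule that)
    show "is_kmodel N" by (fact N)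
    show "u \<subseteq> kW N" using uD by (simp add: N_def)
    show "supI N u \<phi>" if \<phi>: "\<phi> \<in> \<Phi>" for \<phi>
    proof -
      obtain \<alpha> where \<alpha>: "\<alpha> \<in> Res \<phi>" "supI M t \<alpha>"
        using \<Phi>[OF \<phi>] supI_Res[of M t \<phi>] by blast
      note sd = std_Res[OF \<alpha>(1)]
      have "supI N {x} \<alpha>" if "x \<in> u" for x
        using truth[OF sd, of x] that uD ut[OF that] \<alpha>(2) supI_flat[OF sd, of M t] by blast
      then have "supI N u \<alpha>" using supI_flat[OF sd, of N u] by blast
      then show ?thesis using supI_Res[of N u \<phi>] \<alpha>(1) by blast
    qed
    show "\<not> supI N u \<psi>"
    proof
      assume "supI N u \<psi>"
      then obtain \<beta> where \<beta>: "\<beta> \<in> Res \<psi>" "supI N u \<beta>"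
        using supI_Res[of N u \<psi>] by blast
      have "e (r \<beta>) \<in> u" using \<beta> by (simp add: u_def)
      then have "supI N {e (r \<beta>)} \<beta>" using supI_mono[OF \<beta>(2)] by simp
      then have "supI M {r \<beta>} \<beta>" using truth[OF std_Res[OF \<beta>(1)]] e rP[OF \<beta>(1)] by simp
      then show False using r \<beta>(1) by blast
    qed
    show "kR N = Id_on (kW N)" if "kR M = Id_on (kW M)"
    proof -
      have "x = y" if "x \<in> D" "y \<in> D" "(g x, g y) \<in> kR M" for x y
        using that \<open>kR M = Id_on (kW M)\<close> ge by (metis Id_onE Pair_inject)
      then show ?thesis using refl DW by (auto simp: N_def)
    qed
  qed
qed

theorem entails_InqI_all_types:
  assumes "\<Phi> \<Turnstile>\<^sub>I \<psi>"
  shows "entails_InqI_over TYPE('w) \<Phi> \<psi>"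
  unfolding entails_InqI_over_def
proof (intro allI impI, rule ccontr)
  fix M :: "('w, 'a) kmodel" and t
  assume *: "is_kmodel M" "t \<subseteq> kW M" "\<forall>\<phi>\<in>\<Phi>. supI M t \<phi>" "\<not> supI M t \<psi>"
  obtain N :: "('a form list, 'a) kmodel" and u where "is_kmodel N" "u \<subseteq> kW N"
    "\<And>\<phi>. \<phi> \<in> \<Phi> \<Longrightarrow> supI N u \<phi>" "\<not> supI N u \<psi>"
  proof (rule countermodel_transfer)
    show "supI M t \<phi>" if "\<phi> \<in> \<Phi>" for \<phi> using *(3) that by blast
  qed (use * in blast)+
  then show False
    using assms unfolding entails_InqI_def entails_InqI_over_def by blast
qed

definition kmodel_of :: "('w, 'p) cmodel \<Rightarrow> ('w, 'p) kmodel" where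
  "kmodel_of M = \<lparr>kW = cW M, kR = Id_on (cW M), kV = cV M\<rparr>"

lemma is_kmodel_of: "is_kmodel (kmodel_of M)"
  by (auto simp: is_kmodel_def kmodel_of_def partial_order_on_def preorder_on_def refl_on_def
      trans_def antisym_def)

lemma supI_kmodel_of: "t \<subseteq> cW M \<Longrightarrow> supI (kmodel_of M) t \<phi> \<longleftrightarrow> supB M t \<phi>"
proof (induction \<phi> arbitrary: t)
  case (Or \<phi> \<psi>)
  have "supI (kmodel_of M) t' \<phi> = supB M t' \<phi>" "supI (kmodel_of M) t' \<psi> = supB M t' \<psi>"
    if "t' \<subseteq> t" for t' using that Or by blast+
  then show ?case unfolding supI.simps supB.simps by (metis Un_upper1 Un_upper2)
next
  case (Imp \<phi> \<psi>)
  have "supI (kmodel_of M) t' \<phi> = supB M t' \<phi>" "supI (kmodel_of M) t' \<psi> = supB M t' \<psi>"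
    if "t' \<subseteq> t" for t' using that Imp by blast+
  moreover have "kR (kmodel_of M) `` t = t" using Imp.prems by (auto simp: kmodel_of_def)
  ultimately show ?case by simp
qed (auto simp: kmodel_of_def)

theorem entails_InqB_all_types:
  assumes "\<Phi> \<Turnstile>\<^sub>B \<psi>"
  shows "entails_InqB_over TYPE('w) \<Phi> \<psi>"
  unfolding entails_InqB_over_def
proof (intro allI impI, rule ccontr)
  fix M :: "('w, 'a) cmodel" and t
  assume t: "t \<subseteq> cW M" and \<Phi>: "\<forall>\<phi>\<in>\<Phi>. supB M t \<phi>" and \<psi>: "\<not> supB M t \<psi>"
  obtain N :: "('a form list, 'a) kmodel" and u where N: "u \<subseteq> kW N"
    "\<And>\<phi>. \<phi> \<in> \<Phi> \<Longrightarrow> supI N u \<phi>" "\<not> supI N u \<psi>" "kR N = Id_on (kW N)"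
    by (rule countermodel_transfer[OF is_kmodel_of[of M], of t \<Phi> \<psi>])
       (use t \<Phi> \<psi> in \<open>auto simp: supI_kmodel_of, auto simp: kmodel_of_def\<close>)
  define C where "C = \<lparr>cW = kW N, cV = kV N\<rparr>"
  have C: "kmodel_of C = N" using N(4) by (simp add: C_def kmodel_of_def)
  have "u \<subseteq> cW C" using N(1) by (simp add: C_def)
  then show False
    using assms N(2,3) supI_kmodel_of[of u C] unfolding C entails_InqB_def entails_InqB_over_def
    by blast
qed

end

theory Submission
  imports Defs
begin

text \<open>
  Over models whose order is the identity, support of \<open>neg_trans \<phi>\<close> and of \<open>\<phi>\<close> coincide, which
  gives the direction from right to left. For the converse, resolutions are flat, so it
  suffices to prove a form of Glivenko's theorem for infinitely many premises: for every world
  \<open>v\<close> there is a classical valuation verifying all \<open>\<alpha>\<close> with \<open>\<not>\<not>\<alpha>\<close> true at \<open>v\<close>. It is read off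
  a maximal set of formulas each finite part of which is true at some successor of \<open>v\<close>. If
  \<open>\<not>\<not>\<beta>\<close> fails at \<open>w\<close>, then \<open>\<not>\<beta>\<close> holds at some successor \<open>v\<close> of \<open>w\<close>; collecting the
  valuations obtained from one such \<open>v\<close> for every resolution \<open>\<beta>\<close> of \<open>\<psi>\<close> yields a classical
  team that supports the premises but not \<open>\<psi>\<close>.
\<close>

section \<open>Persistence along the order and negation at a single world\<close>

lemma std_Neg [simp]: "std (Neg \<alpha>) \<longleftrightarrow> std \<alpha>"
  by (simp add: Neg_def)

text \<open>For implication, transitivity of the order keeps the successors of \<open>t'\<close>
  among those of \<open>t\<close>; for atoms this is persistence of the valuation.\<close>

lemma supI_persistent:
  assumes M: "is_kmodel M"
  shows "supI M t \<phi> \<Longrightarrow> t' \<subseteq> kR M `` t \<Longrightarrow> supI M t' \<phi>"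
proof (induction \<phi> arbitrary: t t')
  case (Atom p)
  then show ?case using M by (fastforce simp: is_kmodel_def)
next
  case (And \<phi> \<psi>)
  show ?case
    using And.IH(1)[OF _ And.prems(2)] And.IH(2)[OF _ And.prems(2)] And.prems(1) by simp
next
  case (Or \<phi> \<psi>)
  from Or.prems(1) obtain a b where ab: "t = a \<union> b" "supI M a \<phi>" "supI M b \<psi>" by auto
  show ?case
  \<comment> \<open>The two parts of \<open>t'\<close> above \<open>a\<close> and above
    \<open>b\<close> cover it and may overlap.\<close>
  proof (rule supI_OrI)
    show "supI M (t' \<inter> kR M `` a) \<phi>" by (rule Or.IH(1)[OF ab(2)]) auto
    show "supI M (t' \<inter> kR M `` b) \<psi>" by (rule Or.IH(2)[OF ab(3)]) auto
    show "t' = t' \<inter> kR M `` a \<union> t' \<inter> kR M `` b" using Or.prems(2) ab(1) by blast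
  qed
next
  case (Imp \<phi> \<psi>)
  have "trans (kR M)"
    using M by (simp add: is_kmodel_def partial_order_on_def preorder_on_def)
  then have "kR M `` t' \<subseteq> kR M `` t" using Imp.prems(2) unfolding trans_def by blast
  then show ?case using Imp.prems(1) by (simp add: subset_trans)
next
  case (IDisj \<phi> \<psi>)
  show ?case
    using IDisj.IH(1)[OF _ IDisj.prems(2)] IDisj.IH(2)[OF _ IDisj.prems(2)] IDisj.prems(1) by auto
qed auto

lemma supI_world_persistent:
  assumes "is_kmodel M" "supI M {w} \<phi>" "(w, v) \<in> kR M"
  shows "supI M {v} \<phi>"
  by (rule supI_persistent[OF assms(1,2)]) (use assms(3) in simp)

text \<open>By downward closure, a nonempty team supporting \<open>\<alpha>\<close> contains a world
  whose singleton supports it, so only singletons need to be inspected.\<close>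

lemma supI_world_Neg: "supI M {w} (Neg \<alpha>) \<longleftrightarrow> (\<forall>v. (w, v) \<in> kR M \<longrightarrow> \<not> supI M {v} \<alpha>)"
proof
  assume "supI M {w} (Neg \<alpha>)"
  then show "\<forall>v. (w, v) \<in> kR M \<longrightarrow> \<not> supI M {v} \<alpha>" by (auto simp: Neg_def)
next
  assume *: "\<forall>v. (w, v) \<in> kR M \<longrightarrow> \<not> supI M {v} \<alpha>"
  have "t = {}" if t: "t \<subseteq> kR M `` {w}" "supI M t \<alpha>" for t
    using * t(1) supI_mono[OF t(2)] by fastforce
  then show "supI M {w} (Neg \<alpha>)" by (simp add: Neg_def)
qed

section \<open>Support of the negative translation\<close>

lemma supI_BigIDisj:
  "xs \<noteq> [] \<Longrightarrow> supI M t (BigIDisj xs) \<longleftrightarrow> (\<exists>\<phi>\<in>set xs. supI M t \<phi>)"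
  by (induction xs rule: BigIDisj.induct) auto

lemma supI_neg_trans:
  "supI M t (neg_trans \<phi>) \<longleftrightarrow> (\<exists>\<alpha>\<in>Res \<phi>. supI M t (Neg (Neg \<alpha>)))"
proof -
  have "enum_set (Res \<phi>) \<noteq> []"
    using enum_set(2)[OF finite_Res] Res_nonempty by (metis set_empty)
  then show ?thesis
    by (simp add: neg_trans_def supI_BigIDisj enum_set finite_Res)
qed

lemma kR_kmodel_of: "x \<in> cW C \<Longrightarrow> (x, y) \<in> kR (kmodel_of C) \<longleftrightarrow> y = x"
  by (auto simp: kmodel_of_def)

text \<open>Under the identity order a double negation collapses at each world, and flatness of
  resolutions carries this over to teams.\<close>

lemma supI_kmodel_of_neg_trans:
  assumes "t \<subseteq> cW C"
  shows "supI (kmodel_of C) t (neg_trans \<phi>) \<longleftrightarrow> supB C t \<phi>"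
proof -
  have "supI (kmodel_of C) t (Neg (Neg \<alpha>)) \<longleftrightarrow> supI (kmodel_of C) t \<alpha>" if "\<alpha> \<in> Res \<phi>" for \<alpha>
  proof -
    have "supI (kmodel_of C) {x} (Neg (Neg \<alpha>)) \<longleftrightarrow> supI (kmodel_of C) {x} \<alpha>" if "x \<in> t" for x
      using that assms by (simp add: supI_world_Neg kR_kmodel_of subset_iff)
    then show ?thesis
      using std_Res[OF that] supI_flat[of \<alpha> _ t] supI_flat[of "Neg (Neg \<alpha>)" _ t] by simp
  qed
  then show ?thesis
    using supI_neg_trans[of _ t \<phi>] supI_Res[of _ t \<phi>] supI_kmodel_of[OF assms] by blast
qed

section \<open>Maximal finitely forced sets\<close>

text \<open>Consistency relative to the successors of \<open>v\<close>. The successor may depend on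
  the finite part: there need not be one at which all of \<open>\<Gamma>\<close> is true.\<close>

definition finitely_forced :: "('w, 'p) kmodel \<Rightarrow> 'w \<Rightarrow> 'p form set \<Rightarrow> bool" where
  "finitely_forced M v \<Gamma> \<longleftrightarrow>
     (\<forall>F. finite F \<longrightarrow> F \<subseteq> \<Gamma> \<longrightarrow> (\<exists>u. (v, u) \<in> kR M \<and> (\<forall>\<alpha>\<in>F. supI M {u} \<alpha>)))"

lemma finitely_forcedD:
  assumes "finitely_forced M v \<Gamma>" "finite F" "F \<subseteq> \<Gamma>"
  obtains u where "(v, u) \<in> kR M" "\<And>\<alpha>. \<alpha> \<in> F \<Longrightarrow> supI M {u} \<alpha>"
proof -
  have "\<exists>u. (v, u) \<in> kR M \<and> (\<forall>\<alpha>\<in>F. supI M {u} \<alpha>)"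
    using assms by (simp add: finitely_forced_def)
  then show thesis using that by (elim exE conjE) simp
qed

text \<open>Zorn's lemma applies because a finite subset of the union of a nonempty chain already
  lies in one member. Reflexivity at \<open>v\<close> makes the empty set finitely forced.\<close>

lemma maximal_finitely_forced:
  assumes "(v, v) \<in> kR M"
  obtains \<Gamma> where "finitely_forced M v \<Gamma>"
    "\<forall>\<alpha>. finitely_forced M v (insert \<alpha> \<Gamma>) \<longrightarrow> \<alpha> \<in> \<Gamma>"
proof -
  let ?A = "{\<Gamma>. finitely_forced M v \<Gamma>}"
  have "\<exists>\<Gamma>\<in>?A. \<forall>X\<in>?A. \<Gamma> \<subseteq> X \<longrightarrow> X = \<Gamma>"
  proof (rule subset_Zorn_nonempty)
    show "?A \<noteq> {}" using assms by (auto simp: finitely_forced_def intro!: exI[of _ "{}"])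
    fix \<C> assume \<C>: "\<C> \<noteq> {}" "subset.chain ?A \<C>"
    show "\<Union>\<C> \<in> ?A"
    proof (clarsimp simp: finitely_forced_def)
      fix F assume "finite F" "F \<subseteq> \<Union>\<C>"
      then obtain \<Gamma> where "\<Gamma> \<in> \<C>" "F \<subseteq> \<Gamma>"
        using finite_subset_Union_chain[OF _ _ \<C>] by blast
      moreover have "finitely_forced M v \<Gamma>"
        using \<open>\<Gamma> \<in> \<C>\<close> \<C>(2) by (auto simp: subset.chain_def)
      ultimately show "\<exists>u. (v, u) \<in> kR M \<and> (\<forall>\<alpha>\<in>F. supI M {u} \<alpha>)"
        using \<open>finite F\<close> by (auto simp: finitely_forced_def)
    qed
  qed
  then obtain \<Gamma> where \<Gamma>: "finitely_forced M v \<Gamma>"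
    "\<And>X. finitely_forced M v X \<Longrightarrow> \<Gamma> \<subseteq> X \<Longrightarrow> X = \<Gamma>" by auto
  show thesis by (rule that[OF \<Gamma>(1)]) (use \<Gamma>(2) in blast)
qed

lemma maximal_finitely_forced_Neg:
  assumes M: "is_kmodel M" and \<Gamma>: "finitely_forced M v \<Gamma>"
    and max: "\<forall>\<alpha>. finitely_forced M v (insert \<alpha> \<Gamma>) \<longrightarrow> \<alpha> \<in> \<Gamma>"
    and \<alpha>: "\<alpha> \<notin> \<Gamma>"
  shows "Neg \<alpha> \<in> \<Gamma>"
proof (rule max[rule_format])
  have tr: "trans (kR M)" using M by (simp add: is_kmodel_def partial_order_on_def preorder_on_def)
  have "\<not> finitely_forced M v (insert \<alpha> \<Gamma>)" using \<alpha> max by blast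
  then obtain F where F: "finite F" "F \<subseteq> insert \<alpha> \<Gamma>"
      and no: "\<not> (\<exists>u. (v, u) \<in> kR M \<and> (\<forall>\<beta>\<in>F. supI M {u} \<beta>))"
    by (auto simp only: finitely_forced_def not_all not_imp)
  show "finitely_forced M v (insert (Neg \<alpha>) \<Gamma>)"
    unfolding finitely_forced_def
  proof (intro allI impI)
    fix G assume G: "finite G" "G \<subseteq> insert (Neg \<alpha>) \<Gamma>"
    \<comment> \<open>\<open>F\<close> witnesses that \<open>\<alpha>\<close> cannot be added. A
      world making \<open>?H\<close> true makes all of \<open>G\<close> true as soon as it makes
      \<open>Neg \<alpha>\<close> true.\<close>
    let ?H = "(F - {\<alpha>}) \<union> (G - {Neg \<alpha>})"
    have "finite ?H" "?H \<subseteq> \<Gamma>" using F G by blast+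
    then obtain u where u: "(v, u) \<in> kR M" "\<And>\<gamma>. \<gamma> \<in> ?H \<Longrightarrow> supI M {u} \<gamma>"
      by (rule finitely_forcedD[OF \<Gamma>]) (rule that)
    \<comment> \<open>By persistence, a successor of \<open>u\<close> making \<open>\<alpha>\<close>
      true would make all of \<open>F\<close> true, against the choice of \<open>F\<close>.\<close>
    have "\<not> supI M {x} \<alpha>" if x: "(u, x) \<in> kR M" for x
    proof
      assume "supI M {x} \<alpha>"
      moreover have "supI M {x} \<gamma>" if "\<gamma> \<in> F - {\<alpha>}" for \<gamma>
        using supI_world_persistent[OF M u(2) x] that by blast
      moreover have "(v, x) \<in> kR M" using tr u(1) x by (rule transD)
      ultimately show False using no by blast
    qed
    then have Neg: "supI M {u} (Neg \<alpha>)" by (simp add: supI_world_Neg)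
    have "supI M {u} \<gamma>" if "\<gamma> \<in> G" for \<gamma>
      using Neg u(2)[of \<gamma>] that by (cases "\<gamma> = Neg \<alpha>") simp_all
    then show "\<exists>u. (v, u) \<in> kR M \<and> (\<forall>\<gamma>\<in>G. supI M {u} \<gamma>)"
      using u(1) by (intro exI[of _ u] conjI ballI)
  qed
qed

section \<open>Glivenko's theorem in terms of valuations\<close>

text \<open>\<open>X\<close> consists of the atoms in a maximal finitely forced set. The claim
  ranges over all models \<open>C\<close> having a world with this valuation, so that one model can
  later be assembled from many such \<open>X\<close>.\<close>

lemma Glivenko_valuation:
  fixes M :: "('w, 'p) kmodel"
  assumes M: "is_kmodel M" and v: "v \<in> kW M"
  shows "\<exists>X. \<forall>(C :: ('c, 'p) cmodel) x \<alpha>. x \<in> cW C \<longrightarrow> (\<forall>p. cV C x p \<longleftrightarrow> p \<in> X) \<longrightarrow>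
    std \<alpha> \<longrightarrow> supI M {v} (Neg (Neg \<alpha>)) \<longrightarrow> supI (kmodel_of C) {x} \<alpha>"
proof -
  have RW: "kR M \<subseteq> kW M \<times> kW M" and refl: "\<And>w. w \<in> kW M \<Longrightarrow> (w, w) \<in> kR M"
    using M unfolding is_kmodel_def partial_order_on_def preorder_on_def refl_on_def by blast+
  obtain \<Gamma> where \<Gamma>: "finitely_forced M v \<Gamma>"
    and max: "\<forall>\<alpha>. finitely_forced M v (insert \<alpha> \<Gamma>) \<longrightarrow> \<alpha> \<in> \<Gamma>"
    using maximal_finitely_forced[OF refl[OF v]] by blast
  note Neg = maximal_finitely_forced_Neg[OF M \<Gamma> max]
  \<comment> \<open>Otherwise \<open>Neg \<alpha>\<close> would lie in \<open>\<Gamma>\<close> and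
    be true together with \<open>F\<close> at some successor of \<open>v\<close>.\<close>
  have closed: "\<alpha> \<in> \<Gamma>" if F: "finite F" "F \<subseteq> \<Gamma>"
    and *: "\<And>u. (v, u) \<in> kR M \<Longrightarrow> (\<And>\<gamma>. \<gamma> \<in> F \<Longrightarrow> supI M {u} \<gamma>) \<Longrightarrow> \<not> supI M {u} (Neg \<alpha>)"
    for F \<alpha>
  proof (rule ccontr)
    assume "\<alpha> \<notin> \<Gamma>"
    then have "Neg \<alpha> \<in> \<Gamma>" by (rule Neg)
    then obtain u where "(v, u) \<in> kR M" "\<And>\<gamma>. \<gamma> \<in> insert (Neg \<alpha>) F \<Longrightarrow> supI M {u} \<gamma>"
      using finitely_forcedD[OF \<Gamma>, of "insert (Neg \<alpha>) F"] F by auto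
    then show False using * by blast
  qed
  \<comment> \<open>Closure under consequence at the successors of \<open>v\<close>: by reflexivity,
    no world makes both \<open>\<alpha>\<close> and \<open>Neg \<alpha>\<close> true.\<close>
  have closed': "\<alpha> \<in> \<Gamma>" if F: "finite F" "F \<subseteq> \<Gamma>"
    and *: "\<And>u. (v, u) \<in> kR M \<Longrightarrow> (\<And>\<gamma>. \<gamma> \<in> F \<Longrightarrow> supI M {u} \<gamma>) \<Longrightarrow> supI M {u} \<alpha>"
    for F \<alpha>
  proof (rule closed[OF F])
    show "\<not> supI M {u} (Neg \<alpha>)"
      if "(v, u) \<in> kR M" "\<And>\<gamma>. \<gamma> \<in> F \<Longrightarrow> supI M {u} \<gamma>" for u
      using *[OF that] refl RW that(1) by (auto simp: supI_world_Neg)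
  qed
  show ?thesis
  proof (intro exI allI impI)
    fix C :: "('c, 'p) cmodel" and x \<alpha>
    assume x: "x \<in> cW C" and X: "\<forall>p. cV C x p \<longleftrightarrow> p \<in> {p. Atom p \<in> \<Gamma>}"
      and sd: "std \<alpha>" and nn: "supI M {v} (Neg (Neg \<alpha>))"
    \<comment> \<open>The truth lemma: membership in \<open>\<Gamma>\<close> obeys the classical
      truth tables of the standard connectives.\<close>
    have "supI (kmodel_of C) {x} \<alpha> \<longleftrightarrow> \<alpha> \<in> \<Gamma>" if "std \<alpha>" for \<alpha>
      using that
    proof (induction \<alpha>)
      case (Atom p)
      then show ?case using X by (simp add: kmodel_of_def)
    next
      case Bot
      have "Bot \<notin> \<Gamma>" using finitely_forcedD[OF \<Gamma>, of "{Bot}"] by auto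
      then show ?case by simp
    next
      case (And \<alpha> \<beta>)
      have "And \<alpha> \<beta> \<in> \<Gamma> \<longleftrightarrow> \<alpha> \<in> \<Gamma> \<and> \<beta> \<in> \<Gamma>"
      proof (intro iffI conjI)
        assume "And \<alpha> \<beta> \<in> \<Gamma>"
        then have "{And \<alpha> \<beta>} \<subseteq> \<Gamma>" by simp
        then show "\<alpha> \<in> \<Gamma>" "\<beta> \<in> \<Gamma>" by (rule closed'[rotated], simp_all)+
      next
        assume "\<alpha> \<in> \<Gamma> \<and> \<beta> \<in> \<Gamma>"
        then have "{\<alpha>, \<beta>} \<subseteq> \<Gamma>" by simp
        then show "And \<alpha> \<beta> \<in> \<Gamma>" by (rule closed'[rotated]) simp_all
      qed
      then show ?case using And by simp
    next
      case (Or \<alpha> \<beta>)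
      have "Or \<alpha> \<beta> \<in> \<Gamma> \<longleftrightarrow> \<alpha> \<in> \<Gamma> \<or> \<beta> \<in> \<Gamma>"
      proof
        assume or: "Or \<alpha> \<beta> \<in> \<Gamma>"
        show "\<alpha> \<in> \<Gamma> \<or> \<beta> \<in> \<Gamma>"
        proof (rule disjCI)
          assume "\<beta> \<notin> \<Gamma>"
          show "\<alpha> \<in> \<Gamma>"
          \<comment> \<open>Primeness from negation completeness: \<open>Neg \<beta>\<close> is in
            \<open>\<Gamma>\<close>, and a world making it true can make the disjunction true only
            through \<open>\<alpha>\<close>.\<close>
          proof (rule closed')
            show "{Or \<alpha> \<beta>, Neg \<beta>} \<subseteq> \<Gamma>" using or Neg[OF \<open>\<beta> \<notin> \<Gamma>\<close>] by simp
            show "supI M {u} \<alpha>" if u: "(v, u) \<in> kR M"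
              and *: "\<And>\<gamma>. \<gamma> \<in> {Or \<alpha> \<beta>, Neg \<beta>} \<Longrightarrow> supI M {u} \<gamma>" for u
              using *[of "Or \<alpha> \<beta>"] *[of "Neg \<beta>"] u refl[of u] RW
              unfolding supI_world_Or supI_world_Neg by blast
          qed simp
        qed
      next
        assume "\<alpha> \<in> \<Gamma> \<or> \<beta> \<in> \<Gamma>"
        then show "Or \<alpha> \<beta> \<in> \<Gamma>"
          using closed'[of "{\<alpha>}" "Or \<alpha> \<beta>"] closed'[of "{\<beta>}" "Or \<alpha> \<beta>"]
          unfolding supI_world_Or by blast
      qed
      then show ?case using Or unfolding supI_world_Or by simp
    next
      case (Imp \<alpha> \<beta>)
      then have sd: "std \<alpha>" "std \<beta>" by simp_all
      have "Imp \<alpha> \<beta> \<in> \<Gamma> \<longleftrightarrow> (\<alpha> \<in> \<Gamma> \<longrightarrow> \<beta> \<in> \<Gamma>)"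
      proof (intro iffI impI)
        assume "Imp \<alpha> \<beta> \<in> \<Gamma>" "\<alpha> \<in> \<Gamma>"
        show "\<beta> \<in> \<Gamma>"
        proof (rule closed')
          show "{Imp \<alpha> \<beta>, \<alpha>} \<subseteq> \<Gamma>" using \<open>Imp \<alpha> \<beta> \<in> \<Gamma>\<close> \<open>\<alpha> \<in> \<Gamma>\<close> by simp
          show "supI M {u} \<beta>" if u: "(v, u) \<in> kR M"
            and *: "\<And>\<gamma>. \<gamma> \<in> {Imp \<alpha> \<beta>, \<alpha>} \<Longrightarrow> supI M {u} \<gamma>" for u
            using *[of "Imp \<alpha> \<beta>"] *[of \<alpha>] u refl[of u] RW
            unfolding supI_world_Imp[OF sd] by blast
        qed simp
      next
        assume "\<alpha> \<in> \<Gamma> \<longrightarrow> \<beta> \<in> \<Gamma>"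
        \<comment> \<open>Negation completeness splits the material conditional into two cases, each
          of which yields the implication intuitionistically.\<close>
        then consider "Neg \<alpha> \<in> \<Gamma>" | "\<beta> \<in> \<Gamma>" using Neg by blast
        then show "Imp \<alpha> \<beta> \<in> \<Gamma>"
        proof cases
          case 1
          show ?thesis
          proof (rule closed'[of "{Neg \<alpha>}"])
            show "supI M {u} (Imp \<alpha> \<beta>)"
              if "\<And>\<gamma>. \<gamma> \<in> {Neg \<alpha>} \<Longrightarrow> supI M {u} \<gamma>" for u
              using that[of "Neg \<alpha>"] unfolding supI_world_Imp[OF sd] supI_world_Neg by simp
          qed (use 1 in simp_all)
        next
          case 2
          show ?thesis
          proof (rule closed'[of "{\<beta>}"])
            show "supI M {u} (Imp \<alpha> \<beta>)"
              if "\<And>\<gamma>. \<gamma> \<in> {\<beta>} \<Longrightarrow> supI M {u} \<gamma>" for u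
              using supI_world_persistent[OF M that[of \<beta>]] unfolding supI_world_Imp[OF sd] by simp
          qed (use 2 in simp_all)
        qed
      qed
      then show ?case
        using Imp x unfolding supI_world_Imp[OF sd] by (simp add: kR_kmodel_of)
    qed simp
    \<comment> \<open>The double negation at \<open>v\<close> says that no successor of
      \<open>v\<close> makes \<open>Neg \<alpha>\<close> true, so the empty set of premises
      suffices.\<close>
    moreover have "\<alpha> \<in> \<Gamma>"
      by (rule closed[of "{}"]) (use nn in \<open>auto simp: supI_world_Neg\<close>)
    ultimately show "supI (kmodel_of C) {x} \<alpha>" using sd by blast
  qed
qed

section \<open>Transfer between classical and intuitionistic entailment\<close>

theorem proposition4p24:
  fixes \<Phi> :: "'p form set" and \<psi> :: "'p form"
  shows "\<Phi> \<Turnstile>\<^sub>B \<psi> \<longleftrightarrow> neg_trans ` \<Phi> \<Turnstile>\<^sub>I neg_trans \<psi>"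
proof
  assume I: "neg_trans ` \<Phi> \<Turnstile>\<^sub>I neg_trans \<psi>"
  show "\<Phi> \<Turnstile>\<^sub>B \<psi>"
    unfolding entails_InqB_def entails_InqB_over_def
  proof (intro allI impI)
    fix C :: "('p form list, 'p) cmodel" and t
    assume t: "t \<subseteq> cW C" and \<Phi>: "\<forall>\<phi>\<in>\<Phi>. supB C t \<phi>"
    have "\<forall>\<phi>\<in>neg_trans ` \<Phi>. supI (kmodel_of C) t \<phi>"
      using \<Phi> supI_kmodel_of_neg_trans[OF t] by blast
    moreover have "t \<subseteq> kW (kmodel_of C)" using t by (simp add: kmodel_of_def)
    ultimately have "supI (kmodel_of C) t (neg_trans \<psi>)"
      using I is_kmodel_of unfolding entails_InqI_def entails_InqI_over_def by blast
    then show "supB C t \<psi>" using supI_kmodel_of_neg_trans[OF t] by blast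
  qed
next
  assume B: "\<Phi> \<Turnstile>\<^sub>B \<psi>"
  show "neg_trans ` \<Phi> \<Turnstile>\<^sub>I neg_trans \<psi>"
    unfolding entails_InqI_def entails_InqI_over_def
  proof (intro allI impI, rule ccontr)
    fix M :: "('p form list, 'p) kmodel" and t
    assume M: "is_kmodel M" and t: "t \<subseteq> kW M"
      and \<Phi>: "\<forall>\<phi>\<in>neg_trans ` \<Phi>. supI M t \<phi>" and \<psi>: "\<not> supI M t (neg_trans \<psi>)"
    have "\<exists>w v. w \<in> t \<and> (w, v) \<in> kR M \<and> supI M {v} (Neg \<beta>)" if \<beta>: "\<beta> \<in> Res \<psi>" for \<beta>
    proof -
      have "\<not> supI M t (Neg (Neg \<beta>))" using \<beta> \<psi> supI_neg_trans by blast
      then obtain w where "w \<in> t" "\<not> supI M {w} (Neg (Neg \<beta>))"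
        using supI_flat[of "Neg (Neg \<beta>)" M t] std_Res[OF \<beta>] by auto
      then show ?thesis using supI_world_Neg[of M w "Neg \<beta>"] by blast
    qed
    then obtain w v where wv: "\<And>\<beta>. \<beta> \<in> Res \<psi> \<Longrightarrow>
        w \<beta> \<in> t \<and> (w \<beta>, v \<beta>) \<in> kR M \<and> supI M {v \<beta>} (Neg \<beta>)" by metis
    have RW: "kR M \<subseteq> kW M \<times> kW M"
      using M unfolding is_kmodel_def partial_order_on_def preorder_on_def by blast
    have "v \<beta> \<in> kW M" if "\<beta> \<in> Res \<psi>" for \<beta> using wv[OF that] RW by blast
    then have "\<forall>\<beta>\<in>Res \<psi>. \<exists>X. \<forall>(C :: ('p form, 'p) cmodel) x \<alpha>. x \<in> cW C \<longrightarrow>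
        (\<forall>p. cV C x p \<longleftrightarrow> p \<in> X) \<longrightarrow> std \<alpha> \<longrightarrow> supI M {v \<beta>} (Neg (Neg \<alpha>)) \<longrightarrow>
        supI (kmodel_of C) {x} \<alpha>"
      by (intro ballI Glivenko_valuation[OF M])
    from bchoice[OF this] obtain X where X: "\<forall>\<beta>\<in>Res \<psi>. \<forall>(C :: ('p form, 'p) cmodel) x \<alpha>.
        x \<in> cW C \<longrightarrow> (\<forall>p. cV C x p \<longleftrightarrow> p \<in> X \<beta>) \<longrightarrow> std \<alpha> \<longrightarrow>
        supI M {v \<beta>} (Neg (Neg \<alpha>)) \<longrightarrow> supI (kmodel_of C) {x} \<alpha>" ..
    \<comment> \<open>The resolutions of \<open>\<psi>\<close> themselves serve as worlds, each
      \<open>\<beta>\<close> carrying the valuation obtained at \<open>v \<beta>\<close>.\<close>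
    define C :: "('p form, 'p) cmodel" where "C = \<lparr>cW = Res \<psi>, cV = (\<lambda>\<beta> p. p \<in> X \<beta>)\<rparr>"
    have W: "cW C = Res \<psi>" by (simp add: C_def)
    have C: "supI (kmodel_of C) {\<beta>} \<alpha>"
      if "\<beta> \<in> Res \<psi>" "std \<alpha>" "supI M {v \<beta>} (Neg (Neg \<alpha>))" for \<alpha> \<beta>
      by (rule X[rule_format, OF that(1) _ _ that(2,3)]) (use that in \<open>simp_all add: C_def\<close>)
    have "supB C (Res \<psi>) \<phi>" if \<phi>: "\<phi> \<in> \<Phi>" for \<phi>
    proof -
      obtain \<alpha> where \<alpha>: "\<alpha> \<in> Res \<phi>" "supI M t (Neg (Neg \<alpha>))"
        using \<Phi> \<phi> supI_neg_trans by blast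
      have "supI (kmodel_of C) {\<beta>} \<alpha>" if \<beta>: "\<beta> \<in> Res \<psi>" for \<beta>
      \<comment> \<open>The double negation holds at \<open>w \<beta>\<close> by downward closure
        and persists to \<open>v \<beta>\<close>.\<close>
      proof (rule C[OF \<beta> std_Res[OF \<alpha>(1)]])
        have "supI M {w \<beta>} (Neg (Neg \<alpha>))" using supI_mono[OF \<alpha>(2)] wv[OF \<beta>] by simp
        then show "supI M {v \<beta>} (Neg (Neg \<alpha>))"
          using supI_world_persistent[OF M] wv[OF \<beta>] by blast
      qed
      then have "supI (kmodel_of C) (Res \<psi>) \<alpha>"
        using supI_flat[OF std_Res[OF \<alpha>(1)]] by blast
      then have "supI (kmodel_of C) (Res \<psi>) \<phi>" using \<alpha>(1) supI_Res by blast
      then show ?thesis by (simp add: supI_kmodel_of W)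
    qed
    \<comment> \<open>The worlds of \<open>C\<close> are formulas rather than lists of formulas,
      hence the passage to another type of worlds.\<close>
    then have "supB C (Res \<psi>) \<psi>"
      using entails_InqB_all_types[OF B, where 'w = "'p form"] W
      unfolding entails_InqB_over_def by blast
    \<comment> \<open>Diagonal step: the resolution supported by the whole team is in particular
      true at the world \<open>\<beta>\<close>, whose valuation was chosen to refute it.\<close>
    then obtain \<beta> where \<beta>: "\<beta> \<in> Res \<psi>" "supI (kmodel_of C) (Res \<psi>) \<beta>"
      using supI_Res supI_kmodel_of[of "Res \<psi>" C] W by blast
    \<comment> \<open>\<open>C\<close> transfers only doubly negated formulas, so
      \<open>Neg \<beta>\<close> is first turned into its own double negation.\<close>
    have "supI M {v \<beta>} (Neg (Neg (Neg \<beta>)))"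
      unfolding supI_world_Neg[of M "v \<beta>"]
    proof (intro allI impI)
      fix u assume u: "(v \<beta>, u) \<in> kR M"
      then have "supI M {u} (Neg \<beta>)" using supI_world_persistent[OF M] wv[OF \<beta>(1)] by blast
      moreover have "(u, u) \<in> kR M"
        using M u RW unfolding is_kmodel_def partial_order_on_def preorder_on_def refl_on_def
        by blast
      ultimately show "\<not> supI M {u} (Neg (Neg \<beta>))"
        using supI_world_Neg[of M u "Neg \<beta>"] by blast
    qed
    then have "supI (kmodel_of C) {\<beta>} (Neg \<beta>)" using C[OF \<beta>(1)] std_Res[OF \<beta>(1)] by simp
    moreover have "supI (kmodel_of C) {\<beta>} \<beta>" using supI_mono[OF \<beta>(2)] \<beta>(1) by simp
    ultimately show False using \<beta>(1) by (simp add: supI_world_Neg kR_kmodel_of W)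
  qed
qed

end
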